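(* Let $M$ be a loopless matroid on a finite ground set $E$. Then $\widetilde{\chi}(M)=\chi(M)$.
   Context: A coloring of $E$ (assigning one color to each element) is proper if every color class is an independent set of $M$. The chromatic number $\chi(M)$ is the minimum number of colors in a proper coloring of $M$. For a positive integer $k$, consider the following game between Alice and Bob on $M$, with colors $1,2,3,\dots$. In round $i=1,2,\dots$, Bob chooses a non-empty set $B_i\subseteq E$ and inserts color $i$ into the lists of all elements of $B_i$ (each list may contain at most $k$ colors, so Bob may only choose elements whose lists currently have fewer than $k$ colors); then Alice chooses an independent set $A_i\subseteq B_i\setminus(A_1\cup\dots\cup A_{i-1})$ and colors its elements with color $i$. The game ends when every element's list contains exactly $k$ colors. Alice wins if at the end every element of $E$ is colored; otherwise Bob wins. $\widetilde{\chi}(M)$ denotes the minimum $k$ for which Alice has a winning strategy. *)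

theory Defs
  imports Complex_Main "HOL-Library.Extended_Nat"
begin

locale matroid =
  fixes E :: "'a set" and indep :: "'a set \<Rightarrow> bool"
  assumes finite_ground: "finite E"
    and indep_subset_ground: "indep I \<Longrightarrow> I \<subseteq> E"
    and indep_empty: "indep {}"
    and indep_hereditary: "indep J \<Longrightarrow> I \<subseteq> J \<Longrightarrow> indep I"
    and indep_augment:
      "indep I \<Longrightarrow> indep J \<Longrightarrow> card I < card J \<Longrightarrow> \<exists>x \<in> J - I. indep (insert x I)"

definition loopless :: "'a set \<Rightarrow> ('a set \<Rightarrow> bool) \<Rightarrow> bool" where
  "loopless E indep \<longleftrightarrow> (\<forall>e \<in> E. indep {e})"

definition proper_coloring :: "'a set \<Rightarrow> ('a set \<Rightarrow> bool) \<Rightarrow> ('a \<Rightarrow> nat) \<Rightarrow> bool" where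
  "proper_coloring E indep c \<longleftrightarrow> (\<forall>i. indep {e \<in> E. c e = i})"

(* Both minima below are infima in enat, so that the value is infinity (and not an unspecified
   natural number) when there is nothing to minimise over. *)
definition chromatic_number :: "'a set \<Rightarrow> ('a set \<Rightarrow> bool) \<Rightarrow> enat" where
  "chromatic_number E indep = (INF c \<in> {c. proper_coloring E indep c}. enat (card (c ` E)))"

(* The list of e after Bob has played Bs = [B_1, ..., B_n]; list positions start at 0,
   colors at 1. *)
definition color_list :: "'a set list \<Rightarrow> 'a \<Rightarrow> nat set" where
  "color_list Bs e = {i. 1 \<le> i \<and> i \<le> length Bs \<and> e \<in> Bs ! (i - 1)}"

definition bob_legal :: "'a set \<Rightarrow> nat \<Rightarrow> 'a set list \<Rightarrow> bool" where
  "bob_legal E k Bs \<longleftrightarrow>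
     (\<forall>i < length Bs. Bs ! i \<noteq> {} \<and> Bs ! i \<subseteq> E \<and>
        (\<forall>e \<in> Bs ! i. card (color_list (take i Bs) e) < k))"

definition game_over :: "'a set \<Rightarrow> nat \<Rightarrow> 'a set list \<Rightarrow> bool" where
  "game_over E k Bs \<longleftrightarrow> (\<forall>e \<in> E. card (color_list Bs e) = k)"

(* A strategy s of Alice answers Bob's moves B_1, ..., B_i with A_i = s [B_1, ..., B_i]; her own
   earlier moves are determined by the prefixes of this list. *)
type_synonym 'a strategy = "'a set list \<Rightarrow> 'a set"

definition colored :: "'a strategy \<Rightarrow> 'a set list \<Rightarrow> 'a set" where
  "colored s Bs = (\<Union>i \<in> {1..length Bs}. s (take i Bs))"

definition alice_legal :: "'a set \<Rightarrow> ('a set \<Rightarrow> bool) \<Rightarrow> nat \<Rightarrow> 'a strategy \<Rightarrow> bool" where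
  "alice_legal E indep k s \<longleftrightarrow>
     (\<forall>Bs B. bob_legal E k (Bs @ [B]) \<longrightarrow>
        indep (s (Bs @ [B])) \<and> s (Bs @ [B]) \<subseteq> B - colored s Bs)"

definition winning_strategy :: "'a set \<Rightarrow> ('a set \<Rightarrow> bool) \<Rightarrow> nat \<Rightarrow> 'a strategy \<Rightarrow> bool" where
  "winning_strategy E indep k s \<longleftrightarrow>
     alice_legal E indep k s \<and>
     (\<forall>Bs. bob_legal E k Bs \<and> game_over E k Bs \<longrightarrow> E \<subseteq> colored s Bs)"

(* k = 0 is admitted only to treat the empty ground set uniformly (its chromatic number is 0);
   by the lemma below, Alice never wins with k = 0 otherwise. *)
definition online_list_chromatic_number :: "'a set \<Rightarrow> ('a set \<Rightarrow> bool) \<Rightarrow> enat" where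
  "online_list_chromatic_number E indep =
     (INF k \<in> {k. \<exists>s. winning_strategy E indep k s}. enat k)"

lemma winning_strategy_pos:
  assumes "winning_strategy E indep k s" and "E \<noteq> {}"
  shows "k > 0"
proof (rule ccontr)
  assume "\<not> k > 0"
  then have "bob_legal E k []" "game_over E k []"
    by (auto simp: bob_legal_def game_over_def color_list_def)
  then have "E \<subseteq> colored s []"
    using assms(1) by (auto simp: winning_strategy_def)
  then show False
    using assms(2) by (simp add: colored_def)
qed

lemma color_list_snoc:
  "color_list (Bs @ [B]) e =
     (if e \<in> B then insert (Suc (length Bs)) (color_list Bs e) else color_list Bs e)"
  by (auto simp: color_list_def nth_append le_Suc_eq)

lemma bob_legal_snoc:
  "bob_legal E k (Bs @ [B]) \<longleftrightarrow>
     bob_legal E k Bs \<and> B \<noteq> {} \<and> B \<subseteq> E \<and> (\<forall>e \<in> B. card (color_list Bs e) < k)"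
  by (auto simp: bob_legal_def nth_append less_Suc_eq)

lemma card_color_list_le:
  "bob_legal E k Bs \<Longrightarrow> card (color_list Bs e) \<le> k"
proof (induction Bs rule: rev_induct)
  case Nil
  have "color_list [] e = {}" by (auto simp: color_list_def)
  then show ?case by simp
next
  case (snoc B Bs)
  have "finite (color_list Bs e)"
    by (rule finite_subset[of _ "{..length Bs}"]) (auto simp: color_list_def)
  with snoc show ?case
    by (auto simp: bob_legal_snoc color_list_snoc card_insert_if Suc_le_eq)
qed

(* No play gets stuck before the game is over, so the completed plays are all that matter. *)
lemma bob_can_move:
  assumes "bob_legal E k Bs" and "\<not> game_over E k Bs"
  shows "\<exists>B. bob_legal E k (Bs @ [B])"
proof -
  obtain e where "e \<in> E" "card (color_list Bs e) \<noteq> k"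
    using assms(2) by (auto simp: game_over_def)
  then have "bob_legal E k (Bs @ [{e}])"
    using assms(1) card_color_list_le[OF assms(1), of e] by (auto simp: bob_legal_snoc)
  then show ?thesis ..
qed

end

theory Submission
  imports Defs
begin

text \<open>
  For a winning strategy with \<open>\<chi>(M)\<close> colors, let \<open>l e\<close> be the number of colors that the list of
  \<open>e\<close> may still receive. Alice maintains a coloring \<open>c\<close> of the uncolored elements, with independent
  classes, such that \<open>c e < l e\<close>. When Bob plays \<open>B\<close>, the elements \<open>e \<in> B\<close> with \<open>c e = l e - 1\<close>
  become illegal. Going through the colors in descending order, Alice moves the illegal elements of
  the current class into her answer \<open>A\<close>; by the multiple symmetric exchange property she can keep
  \<open>A\<close> independent by sending some of its elements, which come from higher classes and
  hence may use the current color, into that class.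
  Conversely, Bob can play \<open>E\<close> in every round.
\<close>

context matroid
begin

section \<open>Rank function and submodularity\<close>

definition rank :: "'a set \<Rightarrow> nat" where
  "rank S = Max (card ` {I. indep I \<and> I \<subseteq> S})"

lemma indep_finite: "indep I \<Longrightarrow> finite I"
  using finite_ground indep_subset_ground finite_subset by blast

lemma finite_indep_sets: "finite {I. indep I \<and> I \<subseteq> S}"
  using finite_ground indep_subset_ground by (auto intro: finite_subset[of _ "Pow E"])

lemma card_le_rank: "indep I \<Longrightarrow> I \<subseteq> S \<Longrightarrow> card I \<le> rank S"
  unfolding rank_def by (rule Max_ge) (use finite_indep_sets in auto)

lemma ex_indep_card_rank: "\<exists>I. indep I \<and> I \<subseteq> S \<and> card I = rank S"
proof -
  have "rank S \<in> card ` {I. indep I \<and> I \<subseteq> S}"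
    unfolding rank_def using indep_empty by (intro Max_in finite_imageI finite_indep_sets) auto
  then show ?thesis by auto
qed

lemma rank_mono: "S \<subseteq> T \<Longrightarrow> rank S \<le> rank T"
  using ex_indep_card_rank[of S] card_le_rank[of _ T] by (metis subset_trans)

text \<open>A smaller independent set can be augmented from one of size \<open>rank S\<close> inside
  \<open>S\<close>; induction on the number of missing elements.\<close>

lemma extend_to_rank:
  assumes "indep J" "J \<subseteq> S"
  shows "\<exists>K. indep K \<and> J \<subseteq> K \<and> K \<subseteq> S \<and> card K = rank S"
  using assms
proof (induction "rank S - card J" arbitrary: J)
  case 0
  then show ?case using card_le_rank[of J S] by auto
next
  case (Suc n)
  obtain I where I: "indep I" "I \<subseteq> S" "card I = rank S"
    using ex_indep_card_rank by blast
  with Suc.hyps(2) have "card J < card I" by linarith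
  then obtain x where x: "x \<in> I - J" "indep (insert x J)"
    using indep_augment Suc.prems(1) I(1) by blast
  have "n = rank S - card (insert x J)"
    using Suc.hyps(2) x indep_finite[OF Suc.prems(1)] by simp
  then have "\<exists>K. indep K \<and> insert x J \<subseteq> K \<and> K \<subseteq> S \<and> card K = rank S"
    using Suc.hyps(1) x I Suc.prems(2) by blast
  then show ?case by blast
qed

text \<open>A maximum independent subset of \<open>T \<union> S\<close> chosen to contain
  \<open>J\<close> has no further elements in \<open>S\<close>, since \<open>J\<close> already
  attains \<open>rank S\<close>; so it lies in \<open>T \<union> J\<close>.\<close>

lemma rank_Un_spanning_le:
  assumes "indep J" "J \<subseteq> S" "card J = rank S"
  shows "rank (T \<union> S) \<le> rank (T \<union> J)"
proof -
  obtain K where K: "indep K" "J \<subseteq> K" "K \<subseteq> T \<union> S" "card K = rank (T \<union> S)"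
    using extend_to_rank[of J "T \<union> S"] assms by blast
  have "K \<inter> S = J"
  proof (rule ccontr)
    assume "K \<inter> S \<noteq> J"
    then have "J \<subset> K \<inter> S" using K(2) assms(2) by blast
    then have "card J < card (K \<inter> S)"
      using K(1) indep_finite by (intro psubset_card_mono) auto
    moreover have "card (K \<inter> S) \<le> rank S"
      using K(1) indep_hereditary by (intro card_le_rank) auto
    ultimately show False using assms(3) by simp
  qed
  then have "K \<subseteq> T \<union> J" using K(3) by blast
  then show ?thesis using card_le_rank[OF K(1)] K(4) by simp
qed

text \<open>Submodularity, with \<open>card I\<close> as a lower bound for the rank of the
  intersection of \<open>I \<union> X\<close> and \<open>I \<union> Y\<close>. If \<open>I\<close>
  is extended to a basis \<open>J\<close> of \<open>I \<union> X\<close> and then to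
  \<open>K\<close>, the part \<open>K - J\<close> lies in \<open>Y\<close> and is independent
  together with \<open>I\<close>.\<close>

lemma rank_Un_submodular:
  assumes "indep I"
  shows "card I + rank (I \<union> X \<union> Y) \<le> rank (I \<union> X) + rank (I \<union> Y)"
proof -
  obtain J where J: "indep J" "I \<subseteq> J" "J \<subseteq> I \<union> X" "card J = rank (I \<union> X)"
    using extend_to_rank[of I "I \<union> X"] assms by blast
  obtain K where K: "indep K" "J \<subseteq> K" "K \<subseteq> I \<union> X \<union> Y" "card K = rank (I \<union> X \<union> Y)"
    using extend_to_rank[of J "I \<union> X \<union> Y"] J by blast
  have "K \<inter> (I \<union> X) = J"
  proof (rule ccontr)
    assume "K \<inter> (I \<union> X) \<noteq> J"
    then have "J \<subset> K \<inter> (I \<union> X)" using K(2) J(3) by blast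
    then have "card J < card (K \<inter> (I \<union> X))"
      using K(1) indep_finite by (intro psubset_card_mono) auto
    moreover have "card (K \<inter> (I \<union> X)) \<le> rank (I \<union> X)"
      using K(1) indep_hereditary by (intro card_le_rank) auto
    ultimately show False using J(4) by simp
  qed
  then have sub: "I \<union> (K - J) \<subseteq> I \<union> Y" using K(3) by blast
  have "card (I \<union> (K - J)) = card I + (card K - card J)"
    using J(2) K(2) indep_finite J(1) K(1) assms
    by (subst card_Un_disjoint) (auto simp: card_Diff_subset)
  moreover have "card (I \<union> (K - J)) \<le> rank (I \<union> Y)"
    using sub J(2) K indep_hereditary by (intro card_le_rank) auto
  ultimately show ?thesis
    using J(4) K(4) card_mono[OF indep_finite[OF K(1)] K(2)] by linarith
qed

section \<open>Partition into two contractions and multiple exchange\<close>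

text \<open>
  The partition theorem for the contractions \<open>M / X\<close> and \<open>M / Y\<close>: if contracting a further
  element \<open>e\<close> in \<open>M / X\<close> violates the rank condition, then a violating set is tight for
  the original condition, and the problem splits along it.
\<close>
lemma partition_contractions:
  assumes "finite I" "indep X" "indep Y" "I \<inter> X = {}" "I \<inter> Y = {}"
    and "\<And>S. S \<subseteq> I \<Longrightarrow> card S + card X + card Y \<le> rank (S \<union> X) + rank (S \<union> Y)"
  shows "\<exists>I1 I2. I = I1 \<union> I2 \<and> indep (I1 \<union> X) \<and> indep (I2 \<union> Y)"
  using assms
proof (induction "card I" arbitrary: I X Y rule: less_induct)
  case less
  note fin = \<open>finite I\<close> and cond = less.prems(6)
  \<comment> \<open>\<open>X\<close> and \<open>Y\<close> are generalized so that the argument also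
    serves with their roles swapped, when it is \<open>Y\<close> that \<open>e\<close>
    extends.\<close>
  have contract: "\<exists>I1 I2. I = I1 \<union> I2 \<and> indep (I1 \<union> X) \<and> indep (I2 \<union> Y)"
    if e: "e \<in> I" "indep (insert e X)" and X: "indep X" and Y: "indep Y"
      and dis: "I \<inter> X = {}" "I \<inter> Y = {}"
      and cond: "\<And>S. S \<subseteq> I \<Longrightarrow> card S + card X + card Y \<le> rank (S \<union> X) + rank (S \<union> Y)"
    for e X Y
  proof (cases "\<forall>S \<subseteq> I - {e}.
      card S + card (insert e X) + card Y \<le> rank (S \<union> insert e X) + rank (S \<union> Y)")
    case True
    have "card (I - {e}) < card I" using e fin by (intro psubset_card_mono) auto
    then have "\<exists>I1 I2. I - {e} = I1 \<union> I2 \<and> indep (I1 \<union> insert e X) \<and> indep (I2 \<union> Y)"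
      by (rule less.hyps) (use True fin e Y dis in auto)
    then obtain I1 I2 where I12: "I - {e} = I1 \<union> I2" "indep (I1 \<union> insert e X)" "indep (I2 \<union> Y)"
      by blast
    have "I = insert e I1 \<union> I2" using I12(1) e by blast
    moreover have "indep (insert e I1 \<union> X)" using I12(2) by simp
    ultimately show ?thesis using I12(3) by blast
  next
    case False
    then obtain S where S: "S \<subseteq> I - {e}"
      "rank (S \<union> insert e X) + rank (S \<union> Y) < card S + card (insert e X) + card Y"
      by (meson not_le)
    have finX: "finite X" "finite Y" using X Y indep_finite by auto
    have finS: "finite S" using S fin finite_subset by blast
    have "e \<notin> X" using e dis by auto
    \<comment> \<open>The violated bound exceeds the original one by only one, and adding
      \<open>e\<close> does not lower the rank, so the original bound is an equality at
      \<open>S\<close>.\<close>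
    then have tight: "rank (S \<union> X) + rank (S \<union> Y) = card S + card X + card Y"
      using S(2) cond[of S] S(1) finX rank_mono[of "S \<union> X" "S \<union> insert e X"]
      by (force simp: subset_insertI2)
    \<comment> \<open>For empty \<open>S\<close> independence of \<open>insert e X\<close> and
      \<open>Y\<close> excludes a violation. Hence \<open>I - S\<close> is smaller than
      \<open>I\<close>; \<open>S\<close> is smaller because it omits \<open>e\<close>.\<close>
    have "S \<noteq> {}"
      using S(2) e card_le_rank[of "insert e X" "insert e X"] card_le_rank[of Y Y] Y
      by (intro notI) simp
    then have smaller: "card S < card I" "card (I - S) < card I"
      using S(1) e fin by (auto intro!: psubset_card_mono)
    have "\<exists>S1 S2. S = S1 \<union> S2 \<and> indep (S1 \<union> X) \<and> indep (S2 \<union> Y)"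
    proof (rule less.hyps[OF smaller(1) finS X Y])
      show "S \<inter> X = {}" "S \<inter> Y = {}" using S(1) dis by auto
      show "card T + card X + card Y \<le> rank (T \<union> X) + rank (T \<union> Y)" if "T \<subseteq> S" for T
        by (rule cond) (use that S(1) in blast)
    qed
    then obtain S1 S2 where S12: "S = S1 \<union> S2" "indep (S1 \<union> X)" "indep (S2 \<union> Y)"
      by blast
    have "finite S1" "finite S2" using finS S12(1) by auto
    then have c: "card (S1 \<union> X) = card S1 + card X" "card (S2 \<union> Y) = card S2 + card Y"
      using dis S(1) S12(1) finX by (auto intro!: card_Un_disjoint)
    have "card (S1 \<union> X) \<le> rank (S \<union> X)" "card (S2 \<union> Y) \<le> rank (S \<union> Y)"
      using S12 by (auto intro!: card_le_rank)
    moreover have "card S \<le> card S1 + card S2" using card_Un_le S12(1) by simp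
    ultimately have span: "card (S1 \<union> X) = rank (S \<union> X)" "card (S2 \<union> Y) = rank (S \<union> Y)"
      using tight c by linarith+
    \<comment> \<open>Subtract the equality at \<open>S\<close> from the condition at
      \<open>T \<union> S\<close>. Since \<open>S1 \<union> X\<close> and
      \<open>S2 \<union> Y\<close> attain the ranks of \<open>S \<union> X\<close> and
      \<open>S \<union> Y\<close>, they can replace them.\<close>
    have cond': "card T + card (S1 \<union> X) + card (S2 \<union> Y)
        \<le> rank (T \<union> (S1 \<union> X)) + rank (T \<union> (S2 \<union> Y))" if T: "T \<subseteq> I - S" for T
    proof -
      have "card (T \<union> S) = card T + card S"
        using T finS finite_subset[OF T] fin by (intro card_Un_disjoint) auto
      moreover have "card (T \<union> S) + card X + card Y \<le> rank (T \<union> (S \<union> X)) + rank (T \<union> (S \<union> Y))"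
        using cond[of "T \<union> S"] T S(1) by (simp add: Un_assoc) blast
      moreover have "rank (T \<union> (S \<union> X)) \<le> rank (T \<union> (S1 \<union> X))"
        "rank (T \<union> (S \<union> Y)) \<le> rank (T \<union> (S2 \<union> Y))"
        using span S12 by (auto intro!: rank_Un_spanning_le)
      ultimately show ?thesis using tight span by linarith
    qed
    have "(I - S) \<inter> (S1 \<union> X) = {}" "(I - S) \<inter> (S2 \<union> Y) = {}"
      using dis S12(1) by auto
    then have "\<exists>T1 T2. I - S = T1 \<union> T2 \<and> indep (T1 \<union> (S1 \<union> X)) \<and> indep (T2 \<union> (S2 \<union> Y))"
      by (intro less.hyps[OF smaller(2) _ S12(2,3)] cond') (use fin in auto)
    then obtain T1 T2 where T12: "I - S = T1 \<union> T2"
      "indep (T1 \<union> (S1 \<union> X))" "indep (T2 \<union> (S2 \<union> Y))"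
      by blast
    have "I = (T1 \<union> S1) \<union> (T2 \<union> S2)" using T12(1) S12(1) S(1) by blast
    moreover have "indep ((T1 \<union> S1) \<union> X)" "indep ((T2 \<union> S2) \<union> Y)"
      using T12(2,3) by (simp_all only: Un_assoc)
    ultimately show ?thesis by blast
  qed
  show ?case
  proof (cases "I = {}")
    case True
    then show ?thesis using less.prems by auto
  next
    case False
    then obtain e where e: "e \<in> I" by blast
    then have "e \<notin> X" "e \<notin> Y" using less.prems by auto
    have "rank ({e} \<union> X) + rank ({e} \<union> Y) > card X + card Y"
      using cond[of "{e}"] e by simp
    then have "rank ({e} \<union> X) > card X \<or> rank ({e} \<union> Y) > card Y" by linarith
    moreover have ins: "indep (insert e Z)" if Z: "indep Z" "rank ({e} \<union> Z) > card Z" for Z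
    proof -
      obtain K where K: "indep K" "Z \<subseteq> K" "K \<subseteq> insert e Z" "card K = rank ({e} \<union> Z)"
        using extend_to_rank[OF Z(1), of "{e} \<union> Z"] by auto
      then have "K \<noteq> Z" using Z(2) by auto
      then have "K = insert e Z" using K by auto
      then show ?thesis using K by simp
    qed
    ultimately consider "indep (insert e X)" | "indep (insert e Y)"
      using less.prems by blast
    then show ?thesis
    proof cases
      case 1
      then show ?thesis using contract[of e X Y] e less.prems by blast
    next
      case 2
      have "\<exists>I1 I2. I = I1 \<union> I2 \<and> indep (I1 \<union> Y) \<and> indep (I2 \<union> X)"
        using contract[of e Y X] 2 e less.prems(2-5) cond by (simp add: ac_simps)
      then show ?thesis by (metis Un_commute)
    qed
  qed
qed

text \<open>Submodularity yields the rank condition of the partition theorem, because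
  \<open>S \<union> X \<union> Y\<close> contains the independent set
  \<open>X \<union> Y\<close>.\<close>

lemma multiple_exchange:
  assumes "indep I" "indep (X \<union> Y)" "X \<inter> Y = {}" "I \<inter> (X \<union> Y) = {}"
  shows "\<exists>I1 I2. I = I1 \<union> I2 \<and> indep (I1 \<union> X) \<and> indep (I2 \<union> Y)"
proof (rule partition_contractions)
  show "indep X" "indep Y" using assms(2) indep_hereditary by auto
  then have "card (X \<union> Y) = card X + card Y"
    using assms(3) indep_finite by (intro card_Un_disjoint) auto
  fix S assume "S \<subseteq> I"
  then have "card S + rank (S \<union> X \<union> Y) \<le> rank (S \<union> X) + rank (S \<union> Y)"
    using assms(1) indep_hereditary by (intro rank_Un_submodular) auto
  moreover have "card (X \<union> Y) \<le> rank (S \<union> X \<union> Y)"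
    using assms(2) by (intro card_le_rank) auto
  ultimately show "card S + card X + card Y \<le> rank (S \<union> X) + rank (S \<union> Y)"
    using \<open>card (X \<union> Y) = card X + card Y\<close> by linarith
qed (use assms indep_finite in auto)

section \<open>Restoring the bounded coloring after one round\<close>

text \<open>The colors of \<open>c\<close> are Alice's plan, not the color numbers of the game.
  Counting from 0 with a strict bound excludes \<open>l e = 0\<close> on \<open>U\<close>, so
  \<open>U\<close> must be empty once all lists are full.\<close>

definition bounded_colorable :: "'a set \<Rightarrow> ('a \<Rightarrow> nat) \<Rightarrow> bool" where
  "bounded_colorable U l \<longleftrightarrow>
     (\<exists>c. (\<forall>e \<in> U. c e < l e) \<and> (\<forall>i. indep {e \<in> U. c e = i}))"

lemma bounded_colorable_step:
  assumes "bounded_colorable U l" "U \<subseteq> E"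
  shows "\<exists>A \<subseteq> B \<inter> U. indep A \<and> bounded_colorable (U - A) (\<lambda>e. if e \<in> B then l e - 1 else l e)"
proof -
  define l' where "l' = (\<lambda>e. if e \<in> B then l e - 1 else l e)"
  \<comment> \<open>Invariant of the descent: classes from \<open>m\<close> upwards obey the lowered
    bound \<open>l'\<close>, the others only \<open>l\<close>. The condition \<open>m < l e\<close>
    on \<open>A\<close> allows its elements to receive color \<open>m - 1\<close> later, even under
    \<open>l'\<close>.\<close>
  define repaired where "repaired m \<longleftrightarrow> (\<exists>A c. A \<subseteq> B \<inter> U \<and> indep A \<and> (\<forall>e \<in> A. m < l e) \<and>
      (\<forall>i. indep {e \<in> U - A. c e = i}) \<and> (\<forall>e \<in> U - A. c e < l e \<and> (m \<le> c e \<longrightarrow> c e < l' e)))" for m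
  obtain c where c: "\<forall>e \<in> U. c e < l e" "\<forall>i. indep {e \<in> U. c e = i}"
    using assms(1) by (auto simp: bounded_colorable_def)
  have "finite U" using assms(2) finite_ground finite_subset by blast
  then obtain n where n: "\<forall>e \<in> U. c e < n"
    using finite_nat_set_iff_bounded[of "c ` U"] by auto
  have "repaired n"
    unfolding repaired_def
  \<comment> \<open>All colors are below \<open>n\<close>, so \<open>l'\<close> constrains nothing
    yet and Alice's answer can start empty.\<close>
  proof (intro exI[of _ "{}"] exI[of _ c] conjI)
    show "\<forall>i. indep {e \<in> U - {}. c e = i}" using c(2) by simp
    show "\<forall>e \<in> U - {}. c e < l e \<and> (n \<le> c e \<longrightarrow> c e < l' e)" using c(1) n by fastforce
  qed (simp_all add: indep_empty)
  moreover have "repaired j" if step: "repaired (Suc j)" for j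
  proof -
    obtain A c where A: "A \<subseteq> B \<inter> U" "indep A" "\<forall>e \<in> A. Suc j < l e"
      and c: "\<forall>i. indep {e \<in> U - A. c e = i}"
      "\<forall>e \<in> U - A. c e < l e \<and> (Suc j \<le> c e \<longrightarrow> c e < l' e)"
      using step unfolding repaired_def by (elim exE conjE) blast
    \<comment> \<open>As \<open>c e < l e\<close>, these are exactly the elements of class
      \<open>j\<close> that break the lowered bound.\<close>
    define X where "X = {e \<in> U - A. c e = j \<and> e \<in> B \<and> l e = Suc j}"
    define Y where "Y = {e \<in> U - A. c e = j} - X"
    have XY: "X \<union> Y = {e \<in> U - A. c e = j}" by (auto simp: X_def Y_def)
    then have "indep (X \<union> Y)" using c(1) by metis
    moreover have "X \<inter> Y = {}" "A \<inter> (X \<union> Y) = {}" by (auto simp: X_def Y_def)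
    ultimately have "\<exists>A1 A2. A = A1 \<union> A2 \<and> indep (A1 \<union> X) \<and> indep (A2 \<union> Y)"
      by (rule multiple_exchange[OF A(2)])
    then obtain A1 A2 where A12: "A = A1 \<union> A2" "indep (A1 \<union> X)" "indep (A2 \<union> Y)"
      by blast
    \<comment> \<open>\<open>A1 \<union> X\<close> becomes the new answer, and \<open>A2\<close>
      joins \<open>Y\<close> in class \<open>j\<close>. An overlap of \<open>A1\<close> and
      \<open>A2\<close> is harmless: such elements stay in the answer, and \<open>c'\<close> is only
      examined outside it.\<close>
    define c' where "c' = (\<lambda>e. if e \<in> A2 then j else c e)"
    have "indep {e \<in> U - (A1 \<union> X). c' e = i}" for i
    proof (cases "i = j")
      case True
      have "{e \<in> U - (A1 \<union> X). c' e = j} \<subseteq> A2 \<union> Y"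
      proof
        fix e assume e: "e \<in> {e \<in> U - (A1 \<union> X). c' e = j}"
        show "e \<in> A2 \<union> Y"
        proof (cases "e \<in> A2")
          case False
          then have "e \<in> {e \<in> U - A. c e = j}" using e A12(1) by (simp add: c'_def)
          then show ?thesis using e XY by blast
        qed simp
      qed
      then show ?thesis using A12(3) indep_hereditary True by blast
    next
      case False
      then have "{e \<in> U - (A1 \<union> X). c' e = i} \<subseteq> {e \<in> U - A. c e = i}"
        using A12(1) by (auto simp: c'_def split: if_splits)
      then show ?thesis using c(1) indep_hereditary by blast
    qed
    moreover have "c' e < l e \<and> (j \<le> c' e \<longrightarrow> c' e < l' e)" if e: "e \<in> U - (A1 \<union> X)" for e
    proof (cases "e \<in> A2")
      case True
      then have "Suc j < l e" using A(3) A12(1) by blast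
      then show ?thesis using True by (auto simp: c'_def l'_def)
    next
      case False
      then have eA: "e \<in> U - A" using e A12(1) by auto
      then have ce: "c e < l e" "Suc j \<le> c e \<Longrightarrow> c e < l' e" using c(2) by auto
      moreover have "j < l' e" if "c e = j"
        using that eA e ce(1) by (auto simp: l'_def X_def)
      ultimately show ?thesis using False by (cases "c e = j") (auto simp: c'_def)
    qed
    moreover have "A1 \<union> X \<subseteq> B \<inter> U" "\<forall>e \<in> A1 \<union> X. j < l e"
      using A A12(1) by (auto simp: X_def dest: Suc_lessD)
    ultimately show ?thesis unfolding repaired_def using A12(2) by blast
  qed
  ultimately have "repaired 0"
    by (induction n) auto
  then show ?thesis unfolding repaired_def bounded_colorable_def l'_def by blast
qed

section \<open>From colorings to winning strategies\<close>

lemma colored_snoc: "colored s (Bs @ [B]) = colored s Bs \<union> s (Bs @ [B])"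
  by (auto simp: colored_def atLeastAtMostSuc_conv)

lemma winning_strategy_if_bounded_colorable:
  assumes "bounded_colorable E (\<lambda>_. k)"
  shows "\<exists>s. winning_strategy E indep k s"
proof -
  define l where "l Bs e = k - card (color_list Bs e)" for Bs :: "'a set list" and e
  define good where "good U Bs B A \<longleftrightarrow>
    A \<subseteq> B \<inter> U \<and> indep A \<and> bounded_colorable (U - A) (l (Bs @ [B]))" for U Bs B A
  \<comment> \<open>A strategy sees only Bob's moves, so Alice's past must be recomputed.
    \<open>R\<close> does this by primitive recursion on the reversed play, whose head is the latest
    move, and returns the set colored so far.\<close>
  define R where "R = rec_list {} (\<lambda>B Bs C. C \<union> (SOME A. good (E - C) (rev Bs) B A))"
  define s where "s Bs = (SOME A. good (E - R (tl (rev Bs))) (butlast Bs) (last Bs) A)" for Bs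
  have "colored s Bs = R (rev Bs)" for Bs
    by (induction Bs rule: rev_induct) (simp_all add: colored_snoc, simp_all add: colored_def R_def s_def)
  then have s: "s (Bs @ [B]) = (SOME A. good (E - colored s Bs) Bs B A)" for Bs B
    by (simp add: s_def)
  \<comment> \<open>Truncated subtraction makes this true even when a list overflows, so the
    invariant below holds for every \<open>Bs\<close>.\<close>
  have l_snoc: "l (Bs @ [B]) e = (if e \<in> B then l Bs e - 1 else l Bs e)" for Bs B e
  proof -
    have "finite (color_list Bs e)" "Suc (length Bs) \<notin> color_list Bs e"
      by (auto simp: color_list_def intro: finite_subset[of _ "{..length Bs}"])
    then show ?thesis by (simp add: l_def color_list_snoc)
  qed
  have good: "good (E - colored s Bs) Bs B (s (Bs @ [B]))"
    if "bounded_colorable (E - colored s Bs) (l Bs)" for Bs B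
  proof -
    have "l (Bs @ [B]) = (\<lambda>e. if e \<in> B then l Bs e - 1 else l Bs e)"
      using l_snoc by blast
    then have "\<exists>A. good (E - colored s Bs) Bs B A"
      using bounded_colorable_step[OF that, of B] by (auto simp: good_def)
    then show ?thesis unfolding s by (rule someI_ex)
  qed
  have inv: "bounded_colorable (E - colored s Bs) (l Bs)" for Bs
  proof (induction Bs rule: rev_induct)
    case Nil
    have "color_list [] e = {}" for e :: 'a
      by (auto simp: color_list_def)
    then have "l [] = (\<lambda>_. k)" by (intro ext) (simp add: l_def)
    then show ?case using assms by (simp add: colored_def)
  next
    case (snoc B Bs)
    then show ?case using good[OF snoc, of B] by (simp add: good_def colored_snoc Diff_eq Int_assoc)
  qed
  have "alice_legal E indep k s"
    unfolding alice_legal_def using good[OF inv] by (fastforce simp: good_def)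
  \<comment> \<open>When the game is over \<open>l Bs\<close> vanishes on \<open>E\<close>, and an
    uncolored element would need a color below 0.\<close>
  moreover have "E \<subseteq> colored s Bs" if "game_over E k Bs" for Bs
    using inv[of Bs] that by (auto simp: bounded_colorable_def l_def game_over_def)
  ultimately show ?thesis unfolding winning_strategy_def by blast
qed

text \<open>The used colors may have gaps; a bijection renumbers them as an initial segment of the
  naturals.\<close>

lemma bounded_colorable_if_proper_coloring:
  assumes "proper_coloring E indep c"
  shows "bounded_colorable E (\<lambda>_. card (c ` E))"
proof -
  obtain f where f: "bij_betw f (c ` E) {0..<card (c ` E)}"
    using ex_bij_betw_finite_nat finite_ground by blast
  have "indep {e \<in> E. f (c e) = i}" for i
  proof (cases "\<exists>e \<in> E. f (c e) = i")
    case True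
    then obtain e where "e \<in> E" "f (c e) = i" by blast
    then have "{e \<in> E. f (c e) = i} = {x \<in> E. c x = c e}"
      using bij_betw_imp_inj_on[OF f] by (auto dest: inj_onD)
    then show ?thesis using assms by (simp add: proper_coloring_def)
  next
    case False
    then have "{e \<in> E. f (c e) = i} = {}" by blast
    then show ?thesis using indep_empty by (simp only:)
  qed
  moreover have "\<forall>e \<in> E. f (c e) < card (c ` E)" using bij_betw_apply[OF f] by auto
  ultimately show ?thesis unfolding bounded_colorable_def by (intro exI[of _ "\<lambda>e. f (c e)"]) simp
qed

section \<open>From winning strategies to colorings\<close>

text \<open>If Bob always plays \<open>E\<close>, all lists fill up simultaneously, so the game ends
  after \<open>k\<close> rounds and Alice's \<open>k\<close> independent answers cover
  \<open>E\<close>. Each element takes as color a round in which it was answered.\<close>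

lemma proper_coloring_if_winning_strategy:
  assumes win: "winning_strategy E indep k s"
  shows "\<exists>c. proper_coloring E indep c \<and> card (c ` E) \<le> k"
\<comment> \<open>Bob's sets must be non-empty, so he can play \<open>E\<close> only in the second
  case.\<close>
proof (cases "E = {}")
  case True
  then show ?thesis using indep_empty by (auto simp: proper_coloring_def)
next
  case False
  have list: "color_list (replicate n E) e = {1..n}" if "e \<in> E" for n e
    using that by (auto simp: color_list_def)
  have legal: "bob_legal E k (replicate n E)" if "n \<le> k" for n
    using that False list by (auto simp: bob_legal_def min_def)
  have "game_over E k (replicate k E)"
    using list by (simp add: game_over_def)
  then have "E \<subseteq> colored s (replicate k E)"
    using win legal[of k] by (simp add: winning_strategy_def)
  then have "\<forall>e \<in> E. \<exists>i \<in> {1..k}. e \<in> s (replicate i E)"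
    by (fastforce simp: colored_def min_def)
  then obtain c where c: "\<forall>e \<in> E. c e \<in> {1..k} \<and> e \<in> s (replicate (c e) E)"
    by metis
  have "indep {e \<in> E. c e = i}" for i
  proof (cases "i \<in> {1..k}")
    case True
    then obtain j where j: "i = Suc j" by (cases i) auto
    have "replicate i E = replicate j E @ [E]" by (simp add: j replicate_append_same)
    moreover from this have "bob_legal E k (replicate j E @ [E])" using legal[of i] True by simp
    ultimately have "indep (s (replicate i E))"
      using win by (simp add: winning_strategy_def alice_legal_def)
    then show ?thesis by (rule indep_hereditary) (use c in auto)
  next
    case False
    then have "{e \<in> E. c e = i} = {}" using c by auto
    then show ?thesis using indep_empty by (simp only:)
  qed
  moreover have "card (c ` E) \<le> card {1..k}"
    using c by (intro card_mono) auto
  ultimately show ?thesis by (auto simp: proper_coloring_def)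
qed

end

theorem theorem2:
  fixes E :: "'a set" and indep :: "'a set \<Rightarrow> bool"
  assumes "matroid E indep" and "loopless E indep"
  shows "online_list_chromatic_number E indep = chromatic_number E indep"
proof (rule antisym)
  interpret matroid E indep by fact
  \<comment> \<open>Both inequalities compare the infima member by member, which also covers an
    empty index set with value infinity.\<close>
  show "online_list_chromatic_number E indep \<le> chromatic_number E indep"
    unfolding online_list_chromatic_number_def chromatic_number_def
    using winning_strategy_if_bounded_colorable bounded_colorable_if_proper_coloring
    by (intro INF_mono) blast
  show "chromatic_number E indep \<le> online_list_chromatic_number E indep"
    unfolding online_list_chromatic_number_def chromatic_number_def
    using proper_coloring_if_winning_strategy by (intro INF_mono) force
qed

end
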